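(* Let $\{A_j\}_{j\in\mathbb J}\in\mathscr F$, let $R\in B(H_o)$ be an invertible operator, and let $\{B_j:=RA_j\}_{j\in\mathbb J}$. Then the following conditions are equivalent. (i) $\{B_j\}_{j\in\mathbb J}$ and $\{A_j\}_{j\in\mathbb J}$ are right-similar. (ii) $(I\otimes R)P_A=P_A(I\otimes R)P_A$ and this operator is invertible in $B(P_A(\ell^2(\mathbb J)\otimes H_o))$. (iii) $P_A^\perp(I\otimes R)P_A=0$ and $P_A^\perp(I\otimes R^{-1})P_A=0$. (iv) For every $i\in\mathbb J$, $RA_i=A_iS_A^{-1}\sum_{j\in\mathbb J}A_j^*RA_j$ and $R^{-1}A_i=A_iS_A^{-1}\sum_{j\in\mathbb J}A_j^*R^{-1}A_j$. (v) For every $i\in\mathbb J$, $RA_i=A_iS_A^{-1}\sum_{j\in\mathbb J}A_j^*RA_j$, and $$\Bigl(\sum_{j\in\mathbb J}A_j^*RA_j\Bigr)^{-1}=S_A^{-1}\Bigl(\sum_{j\in\mathbb J}A_j^*R^{-1}A_j\Bigr)S_A^{-1}.$$ If $R$ is unitary, then these conditions are also equivalent to each of the following: (vi) $(I\otimes R)P_A=P_A(I\otimes R)$. (vii) $R$ commutes with $A_jS_A^{-1}A_i^*$ for all $i,j\in\mathbb J$.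
   Context: Fix Hilbert spaces $H,H_o$ and an index set $\mathbb J$. $\mathscr F$ is the set of operator-valued frames on $H$ with range in $H_o$ indexed by $\mathbb J$: families $\{A_j\}_{j\in\mathbb J}\subset B(H,H_o)$ such that $S_A:=\sum_{j}A_j^*A_j$ converges in the strong operator topology (net of finite partial sums) to a bounded positive invertible operator. $I$ is the identity of $\ell^2(\mathbb J)$. $L_j:H_o\to\ell^2(\mathbb J)\otimes H_o$ is $L_jh=e_j\otimes h$, with $\{e_j\}$ the standard basis. The analysis operator is $\theta_A:=\sum_jL_jA_j$ (strong convergence) and the frame projection $P_A:=\theta_AS_A^{-1}\theta_A^*\in B(\ell^2(\mathbb J)\otimes H_o)$ is the range projection of $\theta_A$; $P_A^\perp$ is the complementary projection. All series over $\mathbb J$ converge in the strong operator topology. Two frames $\{A_j\},\{B_j\}\in\mathscr F$ are right-similar if there is an invertible $T\in B(H)$ with $B_j=A_jT$ for all $j\in\mathbb J$. *)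

theory Defs
  imports "HOL-Analysis.Analysis"
begin

section \<open>Complex Hilbert spaces\<close>

text \<open>
  The inner product is linear in its first argument. The class extends \<^class>\<open>real_inner\<close>, whose
  real inner product, and hence norm and topology, is the real part of the complex one.
\<close>

class complex_inner = real_inner +
  fixes scaleC :: "complex \<Rightarrow> 'a \<Rightarrow> 'a" (infixr "*\<^sub>C" 75)
    and cinner :: "'a \<Rightarrow> 'a \<Rightarrow> complex"
  assumes scaleC_add_right: "c *\<^sub>C (x + y) = c *\<^sub>C x + c *\<^sub>C y"
    and scaleC_add_left: "(c + d) *\<^sub>C x = c *\<^sub>C x + d *\<^sub>C x"
    and scaleC_scaleC: "c *\<^sub>C (d *\<^sub>C x) = (c * d) *\<^sub>C x"
    and scaleC_of_real: "complex_of_real r *\<^sub>C x = r *\<^sub>R x"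
    and cinner_commute: "cinner x y = cnj (cinner y x)"
    and cinner_add_left: "cinner (x + y) z = cinner x z + cinner y z"
    and cinner_scaleC_left: "cinner (c *\<^sub>C x) y = c * cinner x y"
    and inner_eq_Re_cinner: "inner x y = Re (cinner x y)"

class chilbert_space = complex_inner + complete_space

instantiation complex :: chilbert_space
begin

definition scaleC_complex :: "complex \<Rightarrow> complex \<Rightarrow> complex"
  where "scaleC_complex c z = c * z"

definition cinner_complex :: "complex \<Rightarrow> complex \<Rightarrow> complex"
  where "cinner_complex z w = z * cnj w"

instance
  by standard
    (auto simp: scaleC_complex_def cinner_complex_def algebra_simps scaleR_conv_of_real
      inner_complex_def)

end

lemma cinner_self: "cinner x x = complex_of_real ((norm x)\<^sup>2)"
proof -
  have "Im (cinner x x) = 0"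
    using arg_cong[OF cinner_commute[of x x], of Im] by simp
  moreover have "Re (cinner x x) = (norm x)\<^sup>2"
    by (simp add: inner_eq_Re_cinner[symmetric] power2_norm_eq_inner)
  ultimately show ?thesis by (simp add: complex_eq_iff)
qed

lemma cinner_add_right: "cinner x (y + z) = cinner x y + cinner x z"
  by (metis cinner_add_left cinner_commute complex_cnj_add)

lemma cinner_scaleC_right: "cinner x (c *\<^sub>C y) = cnj c * cinner x y"
  by (metis cinner_commute cinner_scaleC_left complex_cnj_mult)

lemma norm_scaleC: "norm (c *\<^sub>C x) = cmod c * norm x"
proof -
  have "cinner (c *\<^sub>C x) (c *\<^sub>C x) = (c * cnj c) * cinner x x"
    by (simp add: cinner_scaleC_left cinner_scaleC_right)
  also have "\<dots> = complex_of_real ((cmod c * norm x)\<^sup>2)"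
    by (simp only: complex_norm_square[symmetric] cinner_self power_mult_distrib of_real_mult
        of_real_power)
  finally have "cinner (c *\<^sub>C x) (c *\<^sub>C x) = complex_of_real ((cmod c * norm x)\<^sup>2)" .
  then have "(norm (c *\<^sub>C x))\<^sup>2 = (cmod c * norm x)\<^sup>2"
    by (metis cinner_self of_real_eq_iff)
  then show ?thesis by simp
qed

lemma cmod_cinner_le: "cmod (cinner x y) \<le> norm x * norm y"
proof (cases "cinner x y = 0")
  case False
  define u where "u = cnj (cinner x y) / cmod (cinner x y)"
  have u: "cmod u = 1" using False by (simp add: u_def norm_divide)
  have "u * cinner x y = cmod (cinner x y)"
    using False complex_norm_square[of "cinner x y"]
    by (simp add: u_def field_simps power2_eq_square)
  then have "cmod (cinner x y) = inner (u *\<^sub>C x) y"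
    by (simp add: inner_eq_Re_cinner cinner_scaleC_left)
  also have "\<dots> \<le> norm (u *\<^sub>C x) * norm y" by (rule norm_cauchy_schwarz)
  finally show ?thesis by (simp add: norm_scaleC u)
qed simp


section \<open>Bounded operators\<close>

definition bounded_clinear :: "('a::complex_inner \<Rightarrow> 'b::complex_inner) \<Rightarrow> bool"
  where "bounded_clinear T \<longleftrightarrow> bounded_linear T \<and> (\<forall>c x. T (c *\<^sub>C x) = c *\<^sub>C T x)"

lemma bounded_clinear_bound:
  assumes "bounded_clinear T"
  obtains K where "\<And>x. norm (T x) \<le> norm x * K" and "0 \<le> K"
proof -
  have "\<exists>K\<ge>0. \<forall>x. norm (T x) \<le> norm x * K"
    using assms by (simp add: bounded_clinear_def bounded_linear.nonneg_bounded)
  then show thesis using that by blast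
qed

lemma bounded_clinear_comp:
  "bounded_clinear T \<Longrightarrow> bounded_clinear U \<Longrightarrow> bounded_clinear (T \<circ> U)"
  by (simp add: bounded_clinear_def o_def bounded_linear_compose[of T U])

lemma bounded_clinear_has_sum:
  "bounded_clinear T \<Longrightarrow> (f has_sum s) F \<Longrightarrow> ((\<lambda>j. T (f j)) has_sum T s) F"
  by (rule has_sum_bounded_linear) (simp_all add: bounded_clinear_def)

definition invertible_op :: "('a::complex_inner \<Rightarrow> 'a) \<Rightarrow> bool"
  where "invertible_op T \<longleftrightarrow> bounded_clinear T \<and>
    (\<exists>U. bounded_clinear U \<and> U \<circ> T = id \<and> T \<circ> U = id)"

text \<open>The adjoint in \<open>B(K, H)\<close> of an operator in \<open>B(H, K)\<close>.\<close>

definition adj :: "('a::chilbert_space \<Rightarrow> 'b::chilbert_space) \<Rightarrow> 'b \<Rightarrow> 'a"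
  where "adj T = (THE U. \<forall>x y. cinner (T x) y = cinner x (U y))"

lemma riesz_real:
  fixes g :: "'a::{real_inner, complete_space} \<Rightarrow> real"
  assumes "bounded_linear g"
  shows "\<exists>y. \<forall>x. g x = inner x y"
proof -
  interpret g: bounded_linear g by fact
  obtain K where K: "\<And>x. \<bar>g x\<bar> \<le> norm x * K" using g.bounded by auto
  define J where "J x = (norm x)\<^sup>2 - 2 * g x" for x
  have lower: "- K\<^sup>2 \<le> J x" for x
  proof -
    have "0 \<le> (norm x - K)\<^sup>2" by simp
    then have "2 * (norm x * K) \<le> (norm x)\<^sup>2 + K\<^sup>2" by (simp add: power2_diff)
    with K[of x] show ?thesis unfolding J_def by linarith
  qed
  define m where "m = Inf (range J)"
  have bdd: "bdd_below (range J)" by (rule bdd_belowI2[of _ "- K\<^sup>2"]) (rule lower)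
  have m: "m \<le> J x" for x unfolding m_def by (rule cInf_lower) (auto simp: bdd)
  have par: "(norm (x - y))\<^sup>2 \<le> 2 * (J x - m) + 2 * (J y - m)" for x y
  proof -
    have "4 * J ((1/2) *\<^sub>R (x + y)) = (norm (x + y))\<^sup>2 - 4 * g (x + y)"
      by (simp add: J_def g.scaleR power_mult_distrib power2_eq_square)
    moreover have "(norm (x + y))\<^sup>2 + (norm (x - y))\<^sup>2 = 2 * (norm x)\<^sup>2 + 2 * (norm y)\<^sup>2"
      by (simp add: power2_norm_eq_inner inner_add inner_diff inner_commute)
    moreover have "4 * m \<le> 4 * J ((1/2) *\<^sub>R (x + y))" using m by simp
    ultimately show ?thesis by (simp add: J_def g.add)
  qed
  have "\<exists>x. J x < m + inverse (real (Suc n))" for n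
    using cInf_lessD[of "range J" "m + inverse (real (Suc n))"] by (auto simp: m_def)
  then obtain X where X: "\<And>n. J (X n) < m + inverse (real (Suc n))" by metis
  have "Cauchy X"
  proof (rule CauchyI)
    fix e :: real assume "0 < e"
    then obtain N where N: "inverse (real (Suc N)) < e\<^sup>2 / 4"
      using reals_Archimedean[of "e\<^sup>2 / 4"] by auto
    have "norm (X i - X j) < e" if "i \<ge> N" "j \<ge> N" for i j
    proof -
      have "J (X k) < m + e\<^sup>2 / 4" if "k \<ge> N" for k
      proof -
        have "inverse (real (Suc k)) \<le> inverse (real (Suc N))"
          by (rule le_imp_inverse_le) (use that in auto)
        then show ?thesis using X[of k] N by (meson add_left_mono le_less_trans less_trans
              add_strict_left_mono)
      qed
      from this[OF that(1)] this[OF that(2)] par[of "X i" "X j"]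
      have "(norm (X i - X j))\<^sup>2 < e\<^sup>2" by (simp add: field_simps)
      then show ?thesis using \<open>0 < e\<close> by (simp add: power2_less_imp_less)
    qed
    then show "\<exists>M. \<forall>i\<ge>M. \<forall>j\<ge>M. norm (X i - X j) < e" by blast
  qed
  then obtain y where y: "X \<longlonglongrightarrow> y" using Cauchy_convergent convergent_def by blast
  have "(\<lambda>n. J (X n)) \<longlonglongrightarrow> J y" unfolding J_def by (intro tendsto_intros g.tendsto y)
  moreover have "(\<lambda>n. m + inverse (real (Suc n))) \<longlonglongrightarrow> m + 0"
    by (intro tendsto_intros LIMSEQ_inverse_real_of_nat)
  ultimately have "J y \<le> m + 0"
    using X by (intro LIMSEQ_le) (auto intro: less_imp_le)
  then have min: "J y \<le> J x" for x using m[of x] by simp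
  have "g x = inner x y" for x
  proof -
    define d where "d = g x - inner x y"
    have quad: "0 \<le> t\<^sup>2 * (norm x)\<^sup>2 - 2 * t * d" for t
    proof -
      have "J (y + t *\<^sub>R x) - J y = t\<^sup>2 * (norm x)\<^sup>2 - 2 * t * d"
        unfolding J_def d_def power2_norm_eq_inner
        by (simp add: inner_add inner_commute g.add g.scaleR algebra_simps power2_eq_square)
      with min[of "y + t *\<^sub>R x"] show ?thesis by simp
    qed
    show ?thesis
    proof (cases "x = 0")
      case False
      define n where "n = (norm x)\<^sup>2"
      have n: "n > 0" using False by (simp add: n_def)
      have "(d / n)\<^sup>2 * n - 2 * (d / n) * d = - (d\<^sup>2 / n)"
        using n by (simp add: field_simps power2_eq_square)
      with quad[of "d / n"] have "d\<^sup>2 / n \<le> 0" unfolding n_def by simp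
      with n have "d\<^sup>2 \<le> 0" by (simp add: divide_le_0_iff)
      then show ?thesis by (simp add: d_def)
    qed (simp add: g.zero)
  qed
  then show ?thesis by blast
qed

lemma cinner_eqI:
  assumes "\<And>x. cinner x y = cinner x z"
  shows "y = z"
proof -
  have "inner x (y - z) = 0" for x
    using arg_cong[OF assms[of x], of Re] by (simp add: inner_diff_right inner_eq_Re_cinner[symmetric])
  then show ?thesis using inner_eq_zero_iff[of "y - z"] by simp
qed

lemma cinner_adj:
  assumes "bounded_clinear T"
  shows "cinner (T x) y = cinner x (adj T y)"
proof -
  have T: "bounded_linear T" "\<And>c x. T (c *\<^sub>C x) = c *\<^sub>C T x"
    using assms by (auto simp: bounded_clinear_def)
  have "\<exists>z. \<forall>x. cinner (T x) y = cinner x z" for y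
  proof -
    obtain z where z: "\<And>x. inner (T x) y = inner x z"
      using riesz_real[OF bounded_linear_compose[OF bounded_linear_inner_left T(1)], of y] by blast
    have "cinner (T x) y = cinner x z" for x
    proof (rule complex_eqI)
      show "Re (cinner (T x) y) = Re (cinner x z)"
        using z[of x] by (simp add: inner_eq_Re_cinner)
      show "Im (cinner (T x) y) = Im (cinner x z)"
        using z[of "\<i> *\<^sub>C x"] by (simp add: inner_eq_Re_cinner T(2) cinner_scaleC_left)
    qed
    then show ?thesis by blast
  qed
  then have "\<forall>y. \<exists>z. \<forall>x. cinner (T x) y = cinner x z" by blast
  then obtain U where "\<forall>y x. cinner (T x) y = cinner x (U y)" unfolding choice_iff by blast
  then have U: "\<forall>x y. cinner (T x) y = cinner x (U y)" by blast
  have "adj T = U"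
    unfolding adj_def
  proof (rule the_equality, rule U)
    fix V assume "\<forall>x y. cinner (T x) y = cinner x (V y)"
    then have "cinner x (V y) = cinner x (U y)" for x y using U by simp
    then have "V y = U y" for y by (rule cinner_eqI)
    then show "V = U" by (rule ext)
  qed
  with U show ?thesis by blast
qed

lemma bounded_clinear_adj:
  assumes "bounded_clinear T"
  shows "bounded_clinear (adj T)"
proof -
  obtain K where K: "\<And>x. norm (T x) \<le> norm x * K" and "0 \<le> K"
    using assms by (rule bounded_clinear_bound) blast
  note [simp] = cinner_adj[OF assms, symmetric]
  have scl: "adj T (c *\<^sub>C y) = c *\<^sub>C adj T y" for c y
    by (rule cinner_eqI) (simp add: cinner_scaleC_right)
  moreover have "bounded_linear (adj T)"
  proof (rule bounded_linear_intro)
    show "adj T (x + y) = adj T x + adj T y" for x y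
      by (rule cinner_eqI) (simp add: cinner_add_right)
    show "adj T (r *\<^sub>R y) = r *\<^sub>R adj T y" for r y
      using scl[of "complex_of_real r" y] by (simp add: scaleC_of_real)
    show "norm (adj T y) \<le> norm y * K" for y
    proof (cases "adj T y = 0")
      case False
      have "norm (adj T y) * norm (adj T y) = cmod (cinner (adj T y) (adj T y))"
        by (simp only: cinner_self norm_of_real power2_eq_square abs_mult abs_norm_cancel)
      also have "\<dots> \<le> norm (T (adj T y)) * norm y"
        using cmod_cinner_le[of "T (adj T y)" y] by simp
      also have "\<dots> \<le> (norm (adj T y) * K) * norm y"
        by (rule mult_right_mono[OF K]) simp
      finally have "norm (adj T y) * norm (adj T y) \<le> norm (adj T y) * (norm y * K)"
        by (simp add: mult_ac)
      with False show ?thesis by simp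
    qed (simp add: \<open>0 \<le> K\<close>)
  qed
  ultimately show ?thesis by (simp add: bounded_clinear_def)
qed

definition positive_op :: "('a::complex_inner \<Rightarrow> 'a) \<Rightarrow> bool"
  where "positive_op T \<longleftrightarrow> (\<forall>x. cinner (T x) x \<in> \<real>\<^sub>\<ge>\<^sub>0)"

definition unitary_op :: "('a::chilbert_space \<Rightarrow> 'a) \<Rightarrow> bool"
  where "unitary_op T \<longleftrightarrow> bounded_clinear T \<and> adj T \<circ> T = id \<and> T \<circ> adj T = id"

text \<open>
  \<open>B(M)\<close> for a subspace \<open>M\<close>; an operator on \<open>M\<close> is represented by any function that agrees with it
  on \<open>M\<close>.
\<close>

definition bounded_clinear_on :: "'a::complex_inner set \<Rightarrow> ('a \<Rightarrow> 'a) \<Rightarrow> bool"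
  where "bounded_clinear_on M T \<longleftrightarrow>
    T ` M \<subseteq> M \<and>
    (\<forall>x\<in>M. \<forall>y\<in>M. T (x + y) = T x + T y) \<and>
    (\<forall>c. \<forall>x\<in>M. T (c *\<^sub>C x) = c *\<^sub>C T x) \<and>
    (\<exists>K. \<forall>x\<in>M. norm (T x) \<le> K * norm x)"

definition invertible_op_on :: "'a::complex_inner set \<Rightarrow> ('a \<Rightarrow> 'a) \<Rightarrow> bool"
  where "invertible_op_on M T \<longleftrightarrow> bounded_clinear_on M T \<and>
    (\<exists>U. bounded_clinear_on M U \<and> (\<forall>x\<in>M. U (T x) = x \<and> T (U x) = x))"

text \<open>
  Series in the strong operator topology, as limits of the net of finite partial sums; the limit
  is required to be a bounded operator.
\<close>

definition sot_has_sum ::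
  "('j \<Rightarrow> 'a::chilbert_space \<Rightarrow> 'b::chilbert_space) \<Rightarrow> ('a \<Rightarrow> 'b) \<Rightarrow> bool"
  where "sot_has_sum T S \<longleftrightarrow> bounded_clinear S \<and> (\<forall>x. ((\<lambda>j. T j x) has_sum S x) UNIV)"

definition sot_sum :: "('j \<Rightarrow> 'a::chilbert_space \<Rightarrow> 'b::chilbert_space) \<Rightarrow> 'a \<Rightarrow> 'b"
  where "sot_sum T = (THE S. sot_has_sum T S)"

lemma sot_sum_eqI:
  assumes "sot_has_sum T S"
  shows "sot_sum T = S"
  unfolding sot_sum_def
proof (rule the_equality, rule assms)
  fix S' assume "sot_has_sum T S'"
  with assms show "S' = S"
    unfolding sot_has_sum_def by (intro ext) (blast intro: has_sum_unique)
qed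


section \<open>Square-summable families\<close>

text \<open>
  \<open>('j, 'h) ell2\<close> is the Hilbert space of square-summable families in \<open>'h\<close>; in particular
  \<open>('j, complex) ell2\<close> is the scalar space.
\<close>

typedef (overloaded) ('j, 'h::chilbert_space) ell2 =
  "{f :: 'j \<Rightarrow> 'h. (\<lambda>j. (norm (f j))\<^sup>2) summable_on UNIV}"
  morphisms coord Abs_ell2
  by (rule exI[of _ "\<lambda>_. 0"]) simp

setup_lifting type_definition_ell2

lemma ell2_summable: "(\<lambda>j. (norm (coord f j))\<^sup>2) summable_on UNIV"
  using coord[of f] by simp

lemma square_summable_add:
  fixes f g :: "'j \<Rightarrow> 'h::real_inner"
  assumes "(\<lambda>j. (norm (f j))\<^sup>2) summable_on UNIV" "(\<lambda>j. (norm (g j))\<^sup>2) summable_on UNIV"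
  shows "(\<lambda>j. (norm (f j + g j))\<^sup>2) summable_on UNIV"
proof (rule summable_on_comparison_test)
  show "(\<lambda>j. 2 * (norm (f j))\<^sup>2 + 2 * (norm (g j))\<^sup>2) summable_on UNIV"
    by (intro summable_on_add summable_on_cmult_right assms)
  fix j
  have "(norm (f j + g j))\<^sup>2 \<le> (norm (f j) + norm (g j))\<^sup>2"
    by (intro power_mono norm_triangle_ineq) simp
  also have "\<dots> \<le> 2 * (norm (f j))\<^sup>2 + 2 * (norm (g j))\<^sup>2"
    using sum_squares_bound[of "norm (f j)" "norm (g j)"] by (simp add: power2_sum)
  finally show "(norm (f j + g j))\<^sup>2 \<le> 2 * (norm (f j))\<^sup>2 + 2 * (norm (g j))\<^sup>2" .
qed simp_all

lemma ell2_cinner_summable: "(\<lambda>j. cinner (coord f j) (coord g j)) summable_on UNIV"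
proof (rule abs_summable_summable, rule Infinite_Sum.abs_summable_on_comparison_test)
  show "(\<lambda>j. norm ((norm (coord f j))\<^sup>2 + (norm (coord g j))\<^sup>2)) summable_on UNIV"
    by (simp add: summable_on_add ell2_summable)
  fix j
  have "cmod (cinner (coord f j) (coord g j)) \<le> norm (coord f j) * norm (coord g j)"
    by (rule cmod_cinner_le)
  also have "\<dots> \<le> (norm (coord f j))\<^sup>2 + (norm (coord g j))\<^sup>2"
  proof -
    have "0 \<le> norm (coord f j) * norm (coord g j)" by simp
    with sum_squares_bound[of "norm (coord f j)" "norm (coord g j)"] show ?thesis
      unfolding mult.assoc by linarith
  qed
  finally show "norm (cinner (coord f j) (coord g j))
      \<le> norm ((norm (coord f j))\<^sup>2 + (norm (coord g j))\<^sup>2)" by simp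
qed

instantiation ell2 :: (type, chilbert_space) real_vector
begin

lift_definition zero_ell2 :: "('a, 'b) ell2" is "\<lambda>_. 0" by simp

lift_definition plus_ell2 :: "('a, 'b) ell2 \<Rightarrow> ('a, 'b) ell2 \<Rightarrow> ('a, 'b) ell2"
  is "\<lambda>f g j. f j + g j" by (rule square_summable_add)

lift_definition uminus_ell2 :: "('a, 'b) ell2 \<Rightarrow> ('a, 'b) ell2" is "\<lambda>f j. - f j" by simp

lift_definition minus_ell2 :: "('a, 'b) ell2 \<Rightarrow> ('a, 'b) ell2 \<Rightarrow> ('a, 'b) ell2"
  is "\<lambda>f g j. f j - g j"
  subgoal for f g using square_summable_add[of f "\<lambda>j. - g j"] by simp
  done

lift_definition scaleR_ell2 :: "real \<Rightarrow> ('a, 'b) ell2 \<Rightarrow> ('a, 'b) ell2"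
  is "\<lambda>r f j. r *\<^sub>R f j"
  by (simp add: power_mult_distrib summable_on_cmult_right)

instance
proof
  fix f g h :: "('a, 'b) ell2" and r s :: real
  show "f + g + h = f + (g + h)" by transfer (simp add: add.assoc)
  show "f + g = g + f" by transfer (simp add: add.commute)
  show "0 + f = f" by transfer simp
  show "- f + f = 0" by transfer simp
  show "f - g = f + - g" by transfer simp
  show "r *\<^sub>R (f + g) = r *\<^sub>R f + r *\<^sub>R g" by transfer (simp add: scaleR_add_right)
  show "(r + s) *\<^sub>R f = r *\<^sub>R f + s *\<^sub>R f" by transfer (simp add: scaleR_add_left)
  show "r *\<^sub>R s *\<^sub>R f = (r * s) *\<^sub>R f" by transfer simp
  show "1 *\<^sub>R f = f" by transfer simp
qed

end

instantiation ell2 :: (type, chilbert_space) complex_inner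
begin

lift_definition scaleC_ell2 :: "complex \<Rightarrow> ('a, 'b) ell2 \<Rightarrow> ('a, 'b) ell2"
  is "\<lambda>c f j. c *\<^sub>C f j"
  by (simp add: norm_scaleC power_mult_distrib summable_on_cmult_right)

definition cinner_ell2 :: "('a, 'b) ell2 \<Rightarrow> ('a, 'b) ell2 \<Rightarrow> complex"
  where "cinner_ell2 f g = (\<Sum>\<^sub>\<infinity>j. cinner (coord f j) (coord g j))"

definition inner_ell2 :: "('a, 'b) ell2 \<Rightarrow> ('a, 'b) ell2 \<Rightarrow> real"
  where "inner_ell2 f g = Re (cinner f g)"

definition norm_ell2 :: "('a, 'b) ell2 \<Rightarrow> real"
  where "norm_ell2 f = sqrt (inner f f)"

definition sgn_ell2 :: "('a, 'b) ell2 \<Rightarrow> ('a, 'b) ell2"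
  where "sgn_ell2 f = f /\<^sub>R norm f"

definition dist_ell2 :: "('a, 'b) ell2 \<Rightarrow> ('a, 'b) ell2 \<Rightarrow> real"
  where "dist_ell2 f g = norm (f - g)"

definition uniformity_ell2 :: "(('a, 'b) ell2 \<times> ('a, 'b) ell2) filter"
  where "uniformity_ell2 = (INF e\<in>{0<..}. principal {(f, g). dist f g < e})"

definition open_ell2 :: "('a, 'b) ell2 set \<Rightarrow> bool"
  where "open_ell2 U = (\<forall>f\<in>U. eventually (\<lambda>(f', g). f' = f \<longrightarrow> g \<in> U) uniformity)"

lemma inner_ell2_self: "inner f f = (\<Sum>\<^sub>\<infinity>j. (norm (coord f j))\<^sup>2)"
  for f :: "('a, 'b) ell2"
proof -
  have "inner f f = (\<Sum>\<^sub>\<infinity>j. Re (cinner (coord f j) (coord f j)))"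
    unfolding inner_ell2_def cinner_ell2_def
    by (rule infsum_Re[OF ell2_cinner_summable, symmetric])
  then show ?thesis by (simp add: cinner_self)
qed

instance
proof
  fix f g h :: "('a, 'b) ell2" and r :: real and c d :: complex
  show "sgn f = f /\<^sub>R norm f" by (rule sgn_ell2_def)
  show "dist f g = norm (f - g)" by (rule dist_ell2_def)
  show "uniformity = (INF e\<in>{0<..}. principal {(f, g :: ('a, 'b) ell2). dist f g < e})"
    by (rule uniformity_ell2_def)
  show "open U = (\<forall>f\<in>U. eventually (\<lambda>(f', g). f' = f \<longrightarrow> g \<in> U) uniformity)"
    for U :: "('a, 'b) ell2 set" by (rule open_ell2_def)
  show "norm f = sqrt (inner f f)" by (rule norm_ell2_def)
  show "c *\<^sub>C (f + g) = c *\<^sub>C f + c *\<^sub>C g" by transfer (simp add: scaleC_add_right)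
  show "(c + d) *\<^sub>C f = c *\<^sub>C f + d *\<^sub>C f" by transfer (simp add: scaleC_add_left)
  show "c *\<^sub>C d *\<^sub>C f = (c * d) *\<^sub>C f" by transfer (simp add: scaleC_scaleC)
  show of_real: "complex_of_real r *\<^sub>C f = r *\<^sub>R f" for r and f :: "('a, 'b) ell2"
    by transfer (simp add: scaleC_of_real)
  show com: "cinner f g = cnj (cinner g f)" for f g :: "('a, 'b) ell2"
    unfolding cinner_ell2_def infsum_cnj[symmetric]
    by (rule infsum_cong) (rule cinner_commute)
  show add: "cinner (f + g) h = cinner f h + cinner g h"
    unfolding cinner_ell2_def
    by (subst infsum_add[symmetric])
      (simp_all add: ell2_cinner_summable plus_ell2.rep_eq cinner_add_left)
  show scl: "cinner (c *\<^sub>C f) g = c * cinner f g" for c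
    unfolding cinner_ell2_def
    by (simp add: scaleC_ell2.rep_eq cinner_scaleC_left infsum_cmult_right ell2_cinner_summable)
  show "inner f g = Re (cinner f g)" by (rule inner_ell2_def)
  show "inner f g = inner g f"
    unfolding inner_ell2_def by (subst com) simp
  show "inner (f + g) h = inner f h + inner g h"
    unfolding inner_ell2_def add by simp
  show "inner (r *\<^sub>R f) g = r * inner f g"
    unfolding inner_ell2_def of_real[symmetric] scl by simp
  show "0 \<le> inner f f"
    unfolding inner_ell2_self by (rule infsum_nonneg) simp
  show "inner f f = 0 \<longleftrightarrow> f = 0"
  proof
    assume "inner f f = 0"
    then have "(norm (coord f j))\<^sup>2 = 0" for j
      unfolding inner_ell2_self by (intro nonneg_infsum_le_0D[of _ UNIV]) (auto simp: ell2_summable)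
    then show "f = 0" by transfer (simp add: fun_eq_iff)
  next
    assume "f = 0"
    then show "inner f f = 0" unfolding inner_ell2_self by (simp add: zero_ell2.rep_eq)
  qed
qed

end

lemma norm_ell2_square: "(norm f)\<^sup>2 = (\<Sum>\<^sub>\<infinity>j. (norm (coord f j))\<^sup>2)"
  for f :: "('j, 'h::chilbert_space) ell2"
  using inner_ell2_self[of f] by (simp only: power2_norm_eq_inner[of f])

lemma sum_coord_le: "finite F \<Longrightarrow> (\<Sum>j\<in>F. (norm (coord f j))\<^sup>2) \<le> (norm f)\<^sup>2"
  unfolding norm_ell2_square by (rule finite_sum_le_infsum) (auto simp: ell2_summable)

lemma norm_coord_le: "norm (coord f j) \<le> norm f"
  using sum_coord_le[of "{j}" f] by (simp add: power2_le_iff_abs_le)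

lemma ell2_boundI:
  fixes f :: "'j \<Rightarrow> 'h::chilbert_space"
  assumes "\<And>F. finite F \<Longrightarrow> (\<Sum>j\<in>F. (norm (f j))\<^sup>2) \<le> B\<^sup>2" and "0 \<le> B"
  shows "(\<lambda>j. (norm (f j))\<^sup>2) summable_on UNIV" and "norm (Abs_ell2 f) \<le> B"
proof -
  show *: "(\<lambda>j. (norm (f j))\<^sup>2) summable_on UNIV"
    by (rule nonneg_bdd_above_summable_on) (auto intro!: bdd_aboveI2 assms)
  have "(norm (Abs_ell2 f))\<^sup>2 \<le> B\<^sup>2"
    unfolding norm_ell2_square using *
    by (simp add: Abs_ell2_inverse) (rule infsum_le_finite_sums[OF *], simp_all add: assms)
  then show "norm (Abs_ell2 f) \<le> B" using assms(2) by (simp add: power2_le_iff_abs_le)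
qed

instance ell2 :: (type, chilbert_space) chilbert_space
proof
  fix X :: "nat \<Rightarrow> ('a, 'b) ell2"
  assume X: "Cauchy X"
  have "Cauchy (\<lambda>n. coord (X n) j)" for j
  proof (rule CauchyI)
    fix e :: real assume "0 < e"
    then obtain M where M: "\<And>m n. m \<ge> M \<Longrightarrow> n \<ge> M \<Longrightarrow> norm (X m - X n) < e"
      using CauchyD[OF X] by blast
    have "norm (coord (X m) j - coord (X n) j) < e" if "m \<ge> M" "n \<ge> M" for m n
      using M[OF that] norm_coord_le[of "X m - X n" j] by (simp add: minus_ell2.rep_eq)
    then show "\<exists>M. \<forall>m\<ge>M. \<forall>n\<ge>M. norm (coord (X m) j - coord (X n) j) < e" by blast
  qed
  then obtain l where l: "\<And>j. (\<lambda>n. coord (X n) j) \<longlonglongrightarrow> l j"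
    unfolding Cauchy_convergent_iff convergent_def by metis
  have key: "(\<Sum>j\<in>F. (norm (coord (X m) j - l j))\<^sup>2) \<le> e\<^sup>2"
    if M: "\<And>m n. m \<ge> M \<Longrightarrow> n \<ge> M \<Longrightarrow> norm (X m - X n) < e" and m: "m \<ge> M" and F: "finite F"
    for M m F and e :: real
  proof (rule LIMSEQ_le_const2)
    show "(\<lambda>n. \<Sum>j\<in>F. (norm (coord (X m) j - coord (X n) j))\<^sup>2)
        \<longlonglongrightarrow> (\<Sum>j\<in>F. (norm (coord (X m) j - l j))\<^sup>2)"
      by (intro tendsto_intros l)
    show "\<exists>N. \<forall>n\<ge>N. (\<Sum>j\<in>F. (norm (coord (X m) j - coord (X n) j))\<^sup>2) \<le> e\<^sup>2"
    proof (intro exI allI impI)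
      fix n assume "n \<ge> M"
      then have "(norm (X m - X n))\<^sup>2 \<le> e\<^sup>2"
        using M[OF m] by (intro power_mono) (auto intro: less_imp_le)
      then show "(\<Sum>j\<in>F. (norm (coord (X m) j - coord (X n) j))\<^sup>2) \<le> e\<^sup>2"
        using sum_coord_le[OF F, of "X m - X n"] by (simp add: minus_ell2.rep_eq)
    qed
  qed
  define D where "D m = Abs_ell2 (\<lambda>j. coord (X m) j - l j)" for m
  have D: "coord (D m) = (\<lambda>j. coord (X m) j - l j) \<and> norm (D m) \<le> e"
    if "\<And>m n. m \<ge> M \<Longrightarrow> n \<ge> M \<Longrightarrow> norm (X m - X n) < e" "m \<ge> M" "0 < e" for M m e
    unfolding D_def using ell2_boundI[of "\<lambda>j. coord (X m) j - l j" e, OF key[OF that(1,2)]] that(3)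
    by (simp add: Abs_ell2_inverse)
  obtain M1 where M1: "\<And>m n. m \<ge> M1 \<Longrightarrow> n \<ge> M1 \<Longrightarrow> norm (X m - X n) < 1"
    using CauchyD[OF X, of 1] by auto
  define L where "L = X M1 - D M1"
  have L: "coord L = l"
    unfolding L_def using D[of M1 1 M1, OF M1] by (simp add: minus_ell2.rep_eq)
  have "X \<longlonglongrightarrow> L"
  proof (rule LIMSEQ_I)
    fix e :: real assume e: "0 < e"
    then obtain M where M: "\<And>m n. m \<ge> M \<Longrightarrow> n \<ge> M \<Longrightarrow> norm (X m - X n) < e / 2"
      using CauchyD[OF X, of "e / 2"] by auto
    have "norm (X m - L) < e" if "m \<ge> M" for m
    proof -
      have D': "coord (D m) = (\<lambda>j. coord (X m) j - l j) \<and> norm (D m) \<le> e / 2"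
        using D[OF M that] e by simp
      then have "X m - L = D m"
        by (simp add: coord_inject[symmetric] minus_ell2.rep_eq L)
      with D' e show ?thesis by simp
    qed
    then show "\<exists>M. \<forall>m\<ge>M. norm (X m - L) < e" by blast
  qed
  then show "convergent X" by (rule convergentI)
qed

lemma coord_sum: "coord (sum f F) i = (\<Sum>j\<in>F. coord (f j) i)"
  by (induction F rule: infinite_finite_induct) (simp_all add: zero_ell2.rep_eq plus_ell2.rep_eq)


section \<open>Tensor products with the scalar space\<close>

text \<open>
  The Hilbert tensor product of \<open>('j, complex) ell2\<close> with \<open>'h\<close> is realised as \<open>('j, 'h) ell2\<close>.
  Lemmas \<open>cinner_tensor\<close> and \<open>closure_span_tensor\<close> are the two properties that determine it up to a
  unique unitary fixing the elementary tensors.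
\<close>

lift_definition ell2_basis :: "'j \<Rightarrow> ('j, complex) ell2" is "\<lambda>j i. if i = j then 1 else 0"
  by (rule finite_nonzero_values_imp_summable_on, rule finite_subset[of _ "{j}" for j]) auto

lift_definition tensor :: "('j, complex) ell2 \<Rightarrow> 'h::chilbert_space \<Rightarrow> ('j, 'h) ell2"
    (infixr "\<otimes>\<^sub>2" 75)
  is "\<lambda>a h j. a j *\<^sub>C h"
  by (simp add: norm_scaleC power_mult_distrib summable_on_cmult_left)

lemma cinner_tensor: "cinner (a \<otimes>\<^sub>2 h) (b \<otimes>\<^sub>2 k) = cinner a b * cinner h k"
proof -
  have "cinner (a \<otimes>\<^sub>2 h) (b \<otimes>\<^sub>2 k) = (\<Sum>\<^sub>\<infinity>j. cinner (coord a j) (coord b j) * cinner h k)"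
    by (simp add: cinner_ell2_def tensor.rep_eq cinner_scaleC_left cinner_scaleC_right
        cinner_complex_def mult_ac)
  also have "\<dots> = cinner a b * cinner h k"
    unfolding cinner_ell2_def by (rule infsum_cmult_left) (simp add: ell2_cinner_summable)
  finally show ?thesis .
qed

lemma has_sum_basis: "((\<lambda>j. ell2_basis j \<otimes>\<^sub>2 coord f j) has_sum f) UNIV"
proof -
  define g where "g j = (norm (coord f j))\<^sup>2" for j
  define s where "s F = (\<Sum>j\<in>F. ell2_basis j \<otimes>\<^sub>2 coord f j)" for F
  have g: "g summable_on UNIV" unfolding g_def by (rule ell2_summable)
  have scl: "0 *\<^sub>C x = 0" "1 *\<^sub>C x = x" for x :: 'b
    using scaleC_of_real[of 0 x] scaleC_of_real[of 1 x] by simp_all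
  have coord_s: "coord (s F) i = (if i \<in> F then coord f i else 0)" if "finite F" for F i
    using that
    by (simp add: s_def coord_sum tensor.rep_eq ell2_basis.rep_eq if_distrib[of "\<lambda>c. c *\<^sub>C _"] scl
        sum.delta cong: if_cong)
  have "(dist (s F) f)\<^sup>2 = infsum g UNIV - sum g F" if F: "finite F" for F
  proof -
    have "(dist (s F) f)\<^sup>2 = (\<Sum>\<^sub>\<infinity>j. (norm (coord (s F - f) j))\<^sup>2)"
      by (simp add: dist_norm norm_ell2_square)
    also have "\<dots> = infsum g (UNIV - F)"
      by (rule infsum_cong_neutral) (auto simp: minus_ell2.rep_eq coord_s[OF F] g_def)
    also have "\<dots> = infsum g UNIV - sum g F"
      using infsum_Diff[OF g, of F] F by simp
    finally show ?thesis .
  qed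
  then have "\<forall>\<^sub>F F in finite_subsets_at_top UNIV. sqrt (infsum g UNIV - sum g F) = dist (s F) f"
    by (intro eventually_finite_subsets_at_top_weakI) (metis real_sqrt_unique zero_le_dist)
  moreover have "((\<lambda>F. sqrt (infsum g UNIV - sum g F)) \<longlongrightarrow> sqrt (infsum g UNIV - infsum g UNIV))
      (finite_subsets_at_top UNIV)"
    using has_sum_infsum[OF g] unfolding has_sum_def by (intro tendsto_intros)
  ultimately have "((\<lambda>F. dist (s F) f) \<longlongrightarrow> 0) (finite_subsets_at_top UNIV)"
    by (auto dest: tendsto_cong)
  then show ?thesis
    unfolding has_sum_def s_def[symmetric] by (rule tendsto_dist_iff[THEN iffD2])
qed

lemma closure_span_tensor: "closure (span (range (\<lambda>(a, h). a \<otimes>\<^sub>2 h))) = UNIV"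
proof -
  have "f \<in> closure (span (range (\<lambda>(a, h). a \<otimes>\<^sub>2 h)))" for f :: "('a, 'b) ell2"
  proof (rule Lim_in_closed_set)
    show "((\<lambda>F. \<Sum>j\<in>F. ell2_basis j \<otimes>\<^sub>2 coord f j) \<longlongrightarrow> f) (finite_subsets_at_top UNIV)"
      using has_sum_basis[of f] by (simp add: has_sum_def)
    have "(\<Sum>j\<in>F. ell2_basis j \<otimes>\<^sub>2 coord f j) \<in> span (range (\<lambda>(a, h). a \<otimes>\<^sub>2 h))" for F
      by (intro span_sum span_base) auto
    then show "\<forall>\<^sub>F F in finite_subsets_at_top UNIV.
        (\<Sum>j\<in>F. ell2_basis j \<otimes>\<^sub>2 coord f j) \<in> closure (span (range (\<lambda>(a, h). a \<otimes>\<^sub>2 h)))"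
      using closure_subset by (intro always_eventually) blast
  qed simp_all
  then show ?thesis by blast
qed

text \<open>The bounded operator \<open>X \<otimes> Y\<close>, characterised by its action on elementary tensors.\<close>

definition tensor_op ::
  "(('j, complex) ell2 \<Rightarrow> ('j, complex) ell2) \<Rightarrow> ('h \<Rightarrow> 'h) \<Rightarrow>
    ('j, 'h::chilbert_space) ell2 \<Rightarrow> ('j, 'h) ell2"
  where "tensor_op X Y = (THE T. bounded_clinear T \<and> (\<forall>a h. T (a \<otimes>\<^sub>2 h) = X a \<otimes>\<^sub>2 Y h))"

lemma tensor_op_id:
  fixes R :: "'a::chilbert_space \<Rightarrow> 'a" and f :: "('j, 'a) ell2" and a :: "('j, complex) ell2"
  assumes R: "bounded_clinear R"
  shows "bounded_clinear (tensor_op id R :: ('j, 'a) ell2 \<Rightarrow> ('j, 'a) ell2)"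
    and "tensor_op id R (a \<otimes>\<^sub>2 h) = a \<otimes>\<^sub>2 R h"
    and "coord (tensor_op id R f) j = R (coord f j)"
proof -
  obtain K where K: "\<And>x. norm (R x) \<le> norm x * K" and "0 \<le> K"
    using R by (rule bounded_clinear_bound) blast
  interpret R: bounded_linear R using R by (simp add: bounded_clinear_def)
  have Rc: "R (c *\<^sub>C x) = c *\<^sub>C R x" for c x using R by (simp add: bounded_clinear_def)
  define T where "T g = Abs_ell2 (\<lambda>j. R (coord g j))" for g :: "('j, 'a) ell2"
  have bound: "(\<Sum>j\<in>F. (norm (R (coord f j)))\<^sup>2) \<le> (norm f * K)\<^sup>2" if "finite F"
    for F and f :: "('j, 'a) ell2"
  proof -
    have "(\<Sum>j\<in>F. (norm (R (coord f j)))\<^sup>2) \<le> (\<Sum>j\<in>F. (norm (coord f j) * K)\<^sup>2)"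
      by (intro sum_mono power_mono K) simp
    also have "\<dots> = (\<Sum>j\<in>F. (norm (coord f j))\<^sup>2) * K\<^sup>2"
      by (simp add: power_mult_distrib sum_distrib_right)
    also have "\<dots> \<le> (norm f)\<^sup>2 * K\<^sup>2"
      by (intro mult_right_mono sum_coord_le that) simp
    finally show ?thesis by (simp add: power_mult_distrib)
  qed
  have coord_T: "coord (T f) j = R (coord f j)" for f j
    using ell2_boundI(1)[OF bound, of f] \<open>0 \<le> K\<close> by (simp add: T_def Abs_ell2_inverse)
  have norm_T: "norm (T f) \<le> norm f * K" for f
    unfolding T_def by (rule ell2_boundI(2)[OF bound]) (simp_all add: \<open>0 \<le> K\<close>)
  have T: "bounded_clinear T"
    unfolding bounded_clinear_def
  proof (intro conjI allI bounded_linear_intro[where K = K])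
    show "T (f + g) = T f + T g" for f g
      by (simp add: coord_inject[symmetric] fun_eq_iff coord_T plus_ell2.rep_eq R.add)
    show "T (r *\<^sub>R f) = r *\<^sub>R T f" for r f
      by (simp add: coord_inject[symmetric] fun_eq_iff coord_T scaleR_ell2.rep_eq R.scaleR)
    show "T (c *\<^sub>C f) = c *\<^sub>C T f" for c f
      by (simp add: coord_inject[symmetric] fun_eq_iff coord_T scaleC_ell2.rep_eq Rc)
  qed (rule norm_T)
  have el: "T (a \<otimes>\<^sub>2 h) = a \<otimes>\<^sub>2 R h" for a h
    by (simp add: coord_inject[symmetric] fun_eq_iff coord_T tensor.rep_eq Rc)
  have eq: "tensor_op id R = T"
    unfolding tensor_op_def
  proof (rule the_equality)
    show "bounded_clinear T \<and> (\<forall>a h. T (a \<otimes>\<^sub>2 h) = id a \<otimes>\<^sub>2 R h)" using T el by simp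
    fix U :: "('j, 'a) ell2 \<Rightarrow> ('j, 'a) ell2"
    assume U: "bounded_clinear U \<and> (\<forall>a h. U (a \<otimes>\<^sub>2 h) = id a \<otimes>\<^sub>2 R h)"
    show "U = T"
    proof
      fix f
      have has_sum_U: "((\<lambda>j. U (ell2_basis j \<otimes>\<^sub>2 coord f j)) has_sum U f) UNIV"
        by (rule bounded_clinear_has_sum[OF conjunct1[OF U] has_sum_basis])
      have has_sum_T: "((\<lambda>j. T (ell2_basis j \<otimes>\<^sub>2 coord f j)) has_sum T f) UNIV"
        by (rule bounded_clinear_has_sum[OF T has_sum_basis])
      have "U (ell2_basis j \<otimes>\<^sub>2 coord f j) = T (ell2_basis j \<otimes>\<^sub>2 coord f j)" for j
        using U by (simp add: el)
      with has_sum_U have "((\<lambda>j. T (ell2_basis j \<otimes>\<^sub>2 coord f j)) has_sum U f) UNIV"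
        by (simp only:)
      then show "U f = T f"
        using has_sum_T by (rule has_sum_unique)
    qed
  qed
  show "bounded_clinear (tensor_op id R :: ('j, 'a) ell2 \<Rightarrow> ('j, 'a) ell2)"
    and "tensor_op id R (a \<otimes>\<^sub>2 h) = a \<otimes>\<^sub>2 R h"
    and "coord (tensor_op id R f) j = R (coord f j)"
    unfolding eq by (rule T el coord_T)+
qed


section \<open>Operator-valued frames\<close>

definition op_valued_frame :: "('j \<Rightarrow> 'h::chilbert_space \<Rightarrow> 'k::chilbert_space) \<Rightarrow> bool"
  where "op_valued_frame A \<longleftrightarrow> (\<forall>j. bounded_clinear (A j)) \<and>
    (\<exists>S. sot_has_sum (\<lambda>j. adj (A j) \<circ> A j) S \<and> positive_op S \<and> invertible_op S)"

definition frame_op :: "('j \<Rightarrow> 'h::chilbert_space \<Rightarrow> 'k::chilbert_space) \<Rightarrow> 'h \<Rightarrow> 'h"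
  where "frame_op A = sot_sum (\<lambda>j. adj (A j) \<circ> A j)"

definition tensor_basis :: "'j \<Rightarrow> 'k::chilbert_space \<Rightarrow> ('j, 'k) ell2"
  where "tensor_basis j h = ell2_basis j \<otimes>\<^sub>2 h"

definition analysis_op ::
  "('j \<Rightarrow> 'h::chilbert_space \<Rightarrow> 'k::chilbert_space) \<Rightarrow> 'h \<Rightarrow> ('j, 'k) ell2"
  where "analysis_op A = sot_sum (\<lambda>j. tensor_basis j \<circ> A j)"

definition frame_proj ::
  "('j \<Rightarrow> 'h::chilbert_space \<Rightarrow> 'k::chilbert_space) \<Rightarrow> ('j, 'k) ell2 \<Rightarrow> ('j, 'k) ell2"
  where "frame_proj A = analysis_op A \<circ> inv (frame_op A) \<circ> adj (analysis_op A)"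

definition frame_proj_compl ::
  "('j \<Rightarrow> 'h::chilbert_space \<Rightarrow> 'k::chilbert_space) \<Rightarrow> ('j, 'k) ell2 \<Rightarrow> ('j, 'k) ell2"
  where "frame_proj_compl A = (\<lambda>f. f - frame_proj A f)"

definition right_similar ::
  "('j \<Rightarrow> 'h::chilbert_space \<Rightarrow> 'k::chilbert_space) \<Rightarrow> ('j \<Rightarrow> 'h \<Rightarrow> 'k) \<Rightarrow> bool"
  where "right_similar A B \<longleftrightarrow> op_valued_frame A \<and> op_valued_frame B \<and>
    (\<exists>T. invertible_op T \<and> (\<forall>j. B j = A j \<circ> T))"

lemma frame_op_has_sum:
  assumes "op_valued_frame A"
  shows "sot_has_sum (\<lambda>j. adj (A j) \<circ> A j) (frame_op A)"
  using assms sot_sum_eqI unfolding op_valued_frame_def frame_op_def by blast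

text \<open>The series that define the analysis operator and \<open>\<Sum>\<^sub>j A\<^sub>j\<^sup>* R A\<^sub>j\<close> always converge.\<close>

lemma analysis_op_has_sum:
  assumes A: "op_valued_frame A"
  shows "sot_has_sum (\<lambda>j. tensor_basis j \<circ> A j) (analysis_op A)"
    and "coord (analysis_op A x) j = A j x"
proof -
  let ?S = "frame_op A"
  have bA: "bounded_clinear (A j)" for j using A by (simp add: op_valued_frame_def)
  have A_lin: "A j (x + y) = A j x + A j y" "A j (r *\<^sub>R x) = r *\<^sub>R A j x"
      "A j (c *\<^sub>C x) = c *\<^sub>C A j x" for j x y r c
    using bA[of j] unfolding bounded_clinear_def bounded_linear_def
    by (auto simp: linear_add linear_scale)
  have S: "bounded_clinear ?S" "\<And>x. ((\<lambda>j. adj (A j) (A j x)) has_sum ?S x) UNIV"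
    using frame_op_has_sum[OF A] by (auto simp: sot_has_sum_def)
  obtain K where K: "\<And>x. norm (?S x) \<le> norm x * K" and "0 \<le> K"
    using S(1) by (rule bounded_clinear_bound) blast
  have energy: "((\<lambda>j. (norm (A j x))\<^sup>2) has_sum inner x (?S x)) UNIV" for x
  proof -
    have "((\<lambda>j. inner x (adj (A j) (A j x))) has_sum inner x (?S x)) UNIV"
      by (rule has_sum_bounded_linear[OF bounded_linear_inner_right S(2)])
    moreover have "inner x (adj (A j) (A j x)) = (norm (A j x))\<^sup>2" for j
      by (simp add: inner_eq_Re_cinner cinner_adj[OF bA, symmetric] cinner_self)
    ultimately show ?thesis by simp
  qed
  have bound: "(\<Sum>j\<in>F. (norm (A j x))\<^sup>2) \<le> (norm x * sqrt K)\<^sup>2" if F: "finite F" for F x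
  proof -
    have "(\<Sum>j\<in>F. (norm (A j x))\<^sup>2) \<le> inner x (?S x)"
      by (rule finite_sum_le_has_sum[OF energy]) (auto simp: F)
    also have "\<dots> \<le> norm x * norm (?S x)" by (rule norm_cauchy_schwarz)
    also have "\<dots> \<le> norm x * (norm x * K)" by (intro mult_left_mono K) simp
    finally show ?thesis
      using real_sqrt_pow2[OF \<open>0 \<le> K\<close>]
      by (simp add: power_mult_distrib power2_eq_square[of "norm x"] mult_ac)
  qed
  define \<theta> where "\<theta> x = Abs_ell2 (\<lambda>j. A j x)" for x
  have coord: "coord (\<theta> x) j = A j x" for x j
    using ell2_boundI(1)[OF bound, of x] \<open>0 \<le> K\<close> by (simp add: \<theta>_def Abs_ell2_inverse)
  have "bounded_clinear \<theta>"
    unfolding bounded_clinear_def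
  proof (intro conjI allI bounded_linear_intro[where K = "sqrt K"])
    show "norm (\<theta> x) \<le> norm x * sqrt K" for x
      unfolding \<theta>_def by (rule ell2_boundI(2)[OF bound]) (simp_all add: \<open>0 \<le> K\<close>)
  qed (simp_all add: coord_inject[symmetric] fun_eq_iff coord plus_ell2.rep_eq
      scaleR_ell2.rep_eq scaleC_ell2.rep_eq A_lin)
  moreover have "((\<lambda>j. (tensor_basis j \<circ> A j) x) has_sum \<theta> x) UNIV" for x
    using has_sum_basis[of "\<theta> x"] by (simp add: tensor_basis_def coord)
  ultimately have \<theta>: "sot_has_sum (\<lambda>j. tensor_basis j \<circ> A j) \<theta>"
    by (simp add: sot_has_sum_def)
  moreover have "analysis_op A = \<theta>"
    unfolding analysis_op_def by (rule sot_sum_eqI[OF \<theta>])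
  ultimately show "sot_has_sum (\<lambda>j. tensor_basis j \<circ> A j) (analysis_op A)"
    and "coord (analysis_op A x) j = A j x" by (simp_all add: coord)
qed

lemma frame_sandwich_has_sum:
  assumes A: "op_valued_frame A" and R: "bounded_clinear R"
  shows "sot_has_sum (\<lambda>j. adj (A j) \<circ> R \<circ> A j)
    (adj (analysis_op A) \<circ> tensor_op id R \<circ> analysis_op A)"
proof -
  let ?\<theta> = "analysis_op A"
  have bA: "bounded_clinear (A j)" for j using A by (simp add: op_valued_frame_def)
  have b\<theta>: "bounded_clinear ?\<theta>"
    using analysis_op_has_sum(1)[OF A] by (simp add: sot_has_sum_def)
  have comp: "bounded_clinear (adj ?\<theta> \<circ> tensor_op id R \<circ> ?\<theta>)"
    by (intro bounded_clinear_comp bounded_clinear_adj b\<theta> tensor_op_id(1) R)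
  have basis: "adj ?\<theta> (ell2_basis j \<otimes>\<^sub>2 h) = adj (A j) h" for j h
  proof (rule cinner_eqI)
    fix x
    have "cinner x (adj ?\<theta> (ell2_basis j \<otimes>\<^sub>2 h)) = cinner (?\<theta> x) (ell2_basis j \<otimes>\<^sub>2 h)"
      by (simp add: cinner_adj[OF b\<theta>])
    also have "\<dots> = (\<Sum>\<^sub>\<infinity>i\<in>{j}. cinner (A i x) h)"
      unfolding cinner_ell2_def
      by (rule infsum_cong_neutral)
        (auto simp: tensor.rep_eq ell2_basis.rep_eq cinner_scaleC_right
          analysis_op_has_sum(2)[OF A])
    also have "\<dots> = cinner x (adj (A j) h)" by (simp add: cinner_adj[OF bA])
    finally show "cinner x (adj ?\<theta> (ell2_basis j \<otimes>\<^sub>2 h)) = cinner x (adj (A j) h)" .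
  qed
  have "((\<lambda>j. adj (A j) (R (A j x))) has_sum adj ?\<theta> (tensor_op id R (?\<theta> x))) UNIV" for x
  proof -
    let ?f = "tensor_op id R (?\<theta> x)"
    have "((\<lambda>j. adj ?\<theta> (ell2_basis j \<otimes>\<^sub>2 coord ?f j)) has_sum adj ?\<theta> ?f) UNIV"
      by (rule bounded_clinear_has_sum[OF bounded_clinear_adj[OF b\<theta>] has_sum_basis])
    then show ?thesis
      by (simp add: basis tensor_op_id(3)[OF R] analysis_op_has_sum(2)[OF A])
  qed
  with comp show ?thesis by (simp add: sot_has_sum_def)
qed

end

theory Submission
  imports Defs
begin

text \<open>
  Write \<open>\<theta>\<close> for the analysis operator, \<open>S = \<theta>\<^sup>*\<theta>\<close> for the frame operator, \<open>P = \<theta>S\<^sup>-\<^sup>1\<theta>\<^sup>*\<close> for the frame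
  projection, and \<open>V = I \<otimes> R\<close>, \<open>W = I \<otimes> R\<^sup>-\<^sup>1\<close>, so that \<open>W\<close> is the inverse of \<open>V\<close>. Everything is
  compared with the statement that the range of \<open>\<theta>\<close>, which is the range of \<open>P\<close>, is invariant under
  both \<open>V\<close> and \<open>W\<close>, that is, \<open>VP = PVP\<close> and \<open>WP = PWP\<close>.

  The coordinates of \<open>\<theta>x\<close> are the vectors \<open>A\<^sub>j x\<close>. Therefore \<open>TA\<^sub>j = A\<^sub>jU\<close> for all \<open>j\<close> means that
  \<open>(I \<otimes> T)\<theta> = \<theta>U\<close> (\<open>intertwines_iff\<close>). Since \<open>\<theta>\<close> has the left inverse \<open>S\<^sup>-\<^sup>1\<theta>\<^sup>*\<close>, the only possible \<open>U\<close> is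
  \<open>S\<^sup>-\<^sup>1\<theta>\<^sup>*(I \<otimes> T)\<theta> = S\<^sup>-\<^sup>1\<Sum>\<^sub>j A\<^sub>j\<^sup>*TA\<^sub>j\<close>, and it exists exactly when the range of \<open>\<theta>\<close> is invariant under
  \<open>I \<otimes> T\<close> (\<open>intertwines_iff_invariant\<close>). For \<open>T = R\<close> and \<open>T = R\<^sup>-\<^sup>1\<close> the two operators \<open>U\<close> are inverse to
  each other, because \<open>V\<close> and \<open>W\<close> are and \<open>\<theta>\<close> is injective; this turns the two invariance conditions
  into right similarity, and conversely (\<open>ex_intertwiner_iff\<close>).

  If \<open>R\<close> is unitary then \<open>W = V\<^sup>*\<close>, and the adjoint of \<open>WP = PWP\<close> is \<open>PV = PVP\<close>; together with
  \<open>VP = PVP\<close> this says that \<open>V\<close> commutes with \<open>P\<close>. Finally \<open>A\<^sub>jS\<^sup>-\<^sup>1A\<^sub>i\<^sup>*\<close> are the matrix entries of \<open>P\<close>,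
  and \<open>V\<close> is the diagonal matrix with entries \<open>R\<close>.
\<close>

section \<open>Inverses and adjoints of bounded operators\<close>

lemma invertible_opD:
  assumes "invertible_op T"
  shows "bounded_clinear T" and "bounded_clinear (inv T)"
    and "T (inv T x) = x" and "inv T (T x) = x"
proof -
  obtain U where U: "bounded_clinear T" "bounded_clinear U" "U \<circ> T = id" "T \<circ> U = id"
    using assms unfolding invertible_op_def by blast
  have "inv T = U" by (rule inv_unique_comp[OF U(4,3)])
  then show "bounded_clinear T" "bounded_clinear (inv T)" "T (inv T x) = x" "inv T (T x) = x"
    using U(1,2) U(3,4)[THEN fun_cong, of x] by simp_all
qed

lemma invertible_opI:
  assumes "bounded_clinear T" "bounded_clinear U" "\<And>x. U (T x) = x" "\<And>x. T (U x) = x"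
  shows "invertible_op T"
  using assms unfolding invertible_op_def by (auto simp: fun_eq_iff)

lemma invertible_op_inv: "invertible_op T \<Longrightarrow> invertible_op (inv T)"
  by (rule invertible_opI[where U = T]) (simp_all add: invertible_opD)

lemma invertible_op_comp:
  assumes "invertible_op T" "invertible_op U"
  shows "invertible_op (T \<circ> U)"
  by (rule invertible_opI[where U = "inv U \<circ> inv T"])
    (simp_all add: bounded_clinear_comp invertible_opD assms)

lemma adj_comp:
  assumes "bounded_clinear T" "bounded_clinear U"
  shows "adj (T \<circ> U) y = adj U (adj T y)"
  by (rule cinner_eqI)
    (simp add: cinner_adj[symmetric] assms bounded_clinear_comp)

lemma cinner_adj_left:
  assumes "bounded_clinear T"
  shows "cinner (adj T y) x = cinner y (T x)"
  using cinner_adj[OF assms, of x y] by (metis cinner_commute)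

lemma cinner_zero_right: "cinner x 0 = 0"
  using cinner_add_right[of x 0 0] by simp

lemma adj_id: "adj id y = y"
proof -
  have "bounded_clinear (id :: 'a \<Rightarrow> 'a)"
    by (simp add: bounded_clinear_def id_def bounded_linear_ident)
  from cinner_adj[OF this] have "cinner x (adj id y) = cinner x y" for x by (simp only: id_apply)
  then show ?thesis by (rule cinner_eqI)
qed

lemma invertible_op_adj:
  assumes T: "invertible_op T"
  shows "invertible_op (adj T)"
proof (rule invertible_opI[where U = "adj (inv T)"])
  have "inv T \<circ> T = id" "T \<circ> inv T = id" by (auto simp: invertible_opD[OF T])
  then show "adj (inv T) (adj T x) = x" "adj T (adj (inv T) x) = x" for x
    by (simp_all add: adj_comp[symmetric] invertible_opD[OF T] adj_id)
qed (simp_all add: bounded_clinear_adj invertible_opD[OF T])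

lemma inv_unitary_op:
  assumes "unitary_op R"
  shows "inv R = adj R"
  using assms by (intro inv_unique_comp) (simp_all add: unitary_op_def)


section \<open>Amplifications of an operator\<close>

lemma tensor_op_id_comp:
  assumes "bounded_clinear T" "bounded_clinear U" "\<And>x. T (U x) = x"
  shows "tensor_op id T (tensor_op id U f) = f"
  by (simp add: coord_inject[symmetric] fun_eq_iff tensor_op_id(3) assms)

text \<open>The adjoint of \<open>I \<otimes> T\<close> is \<open>I \<otimes> T\<^sup>*\<close>.\<close>

lemma adj_tensor_op_id:
  fixes f g :: "('j, 'a::chilbert_space) ell2"
  assumes T: "bounded_clinear T"
  shows "cinner (tensor_op id T f) g = cinner f (tensor_op id (adj T) g)"
  by (simp add: cinner_ell2_def tensor_op_id(3) T bounded_clinear_adj cinner_adj)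

lemma coord_tensor_basis: "coord (tensor_basis i h) j = (if j = i then h else 0)"
  using scaleC_of_real[of 0 h] scaleC_of_real[of 1 h]
  by (simp add: tensor_basis_def tensor.rep_eq ell2_basis.rep_eq)

text \<open>Bounded operators on square-summable families are determined by their columns.\<close>

lemma bounded_clinear_eq_on_basis:
  assumes "bounded_clinear X" "bounded_clinear Y"
    and eq: "\<And>i h. X (tensor_basis i h) = Y (tensor_basis i h)"
  shows "X = Y"
proof
  fix f
  have "((\<lambda>j. X (tensor_basis j (coord f j))) has_sum X f) UNIV"
    "((\<lambda>j. Y (tensor_basis j (coord f j))) has_sum Y f) UNIV"
    using assms(1,2)[THEN bounded_clinear_has_sum, OF has_sum_basis[of f]]
    by (simp_all add: tensor_basis_def)
  then show "X f = Y f" unfolding eq by (rule has_sum_unique)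
qed


section \<open>The analysis operator and the frame projection\<close>

locale op_frame =
  fixes A :: "'j \<Rightarrow> 'h::chilbert_space \<Rightarrow> 'k::chilbert_space"
  assumes frame: "op_valued_frame A"
begin

abbreviation analysis ("\<theta>") where "\<theta> \<equiv> analysis_op A"
abbreviation frame_operator ("S") where "S \<equiv> frame_op A"
abbreviation projection ("P") where "P \<equiv> frame_proj A"

text \<open>The series \<open>\<Sum>\<^sub>j A\<^sub>j\<^sup>*TA\<^sub>j\<close>.\<close>

abbreviation compression :: "('k \<Rightarrow> 'k) \<Rightarrow> 'h \<Rightarrow> 'h"
  where "compression T \<equiv> sot_sum (\<lambda>j. adj (A j) \<circ> T \<circ> A j)"

lemma bounded_frame: "bounded_clinear (A j)"
  using frame by (simp add: op_valued_frame_def)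

lemma bounded_analysis: "bounded_clinear \<theta>"
  using analysis_op_has_sum(1)[OF frame] by (simp add: sot_has_sum_def)

lemma coord_analysis: "coord (\<theta> x) j = A j x"
  by (rule analysis_op_has_sum(2)[OF frame])

lemma compression_eq:
  "bounded_clinear T \<Longrightarrow> compression T = adj \<theta> \<circ> tensor_op id T \<circ> \<theta>"
  by (rule sot_sum_eqI[OF frame_sandwich_has_sum[OF frame]])

lemma frame_op_eq: "S x = adj \<theta> (\<theta> x)"
proof -
  have id: "bounded_clinear (id :: 'k \<Rightarrow> 'k)"
    by (simp add: bounded_clinear_def id_def bounded_linear_ident)
  have "tensor_op id id f = f" for f :: "('j, 'k) ell2"
    by (simp add: coord_inject[symmetric] fun_eq_iff tensor_op_id(3)[OF id])
  then show ?thesis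
    using compression_eq[OF id] by (simp add: frame_op_def)
qed

lemma frame_op_positive: "positive_op S" and frame_op_invertible: "invertible_op S"
proof -
  obtain S' where "sot_has_sum (\<lambda>j. adj (A j) \<circ> A j) S'" "positive_op S'" "invertible_op S'"
    using frame by (auto simp: op_valued_frame_def)
  moreover from this(1) have "S = S'" unfolding frame_op_def by (rule sot_sum_eqI)
  ultimately show "positive_op S" "invertible_op S" by simp_all
qed

lemmas frame_op_inv = invertible_opD[OF frame_op_invertible]

lemma frame_proj_apply: "P f = \<theta> (inv S (adj \<theta> f))"
  by (simp add: frame_proj_def)

lemma bounded_frame_proj: "bounded_clinear P"
  unfolding frame_proj_def
  by (intro bounded_clinear_comp bounded_clinear_adj bounded_analysis frame_op_inv)

lemma frame_proj_analysis: "P (\<theta> x) = \<theta> x"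
  by (simp add: frame_proj_apply frame_op_eq[symmetric] frame_op_inv)

lemma frame_proj_idem: "P (P f) = P f"
  unfolding frame_proj_apply[of f] by (rule frame_proj_analysis)

lemma analysis_inj: "\<theta> x = \<theta> y \<Longrightarrow> x = y"
  by (metis frame_op_eq frame_op_inv(4))

lemma adj_analysis_basis: "adj \<theta> (tensor_basis i h) = adj (A i) h"
proof (rule cinner_eqI)
  fix x
  have "cinner (\<theta> x) (tensor_basis i h) = (\<Sum>\<^sub>\<infinity>j\<in>{i}. cinner (A j x) h)"
    unfolding cinner_ell2_def
    by (rule infsum_cong_neutral)
      (auto simp: coord_tensor_basis coord_analysis cinner_zero_right)
  then show "cinner x (adj \<theta> (tensor_basis i h)) = cinner x (adj (A i) h)"
    by (simp add: cinner_adj[OF bounded_analysis, symmetric] cinner_adj[OF bounded_frame, symmetric])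
qed

text \<open>The matrix entries of \<open>P\<close> are the operators \<open>A\<^sub>jS\<^sup>-\<^sup>1A\<^sub>i\<^sup>*\<close>.\<close>

lemma coord_frame_proj_basis: "coord (P (tensor_basis i h)) j = A j (inv S (adj (A i) h))"
  by (simp add: frame_proj_apply coord_analysis adj_analysis_basis)

lemma cinner_frame_proj: "cinner (P f) g = cinner f (P g)"
proof -
  have "cinner (S x) y = cinner x (S y)" for x y
    by (simp add: frame_op_eq cinner_adj_left cinner_adj[symmetric] bounded_analysis)
  then have "cinner (inv S x) y = cinner x (inv S y)" for x y
    by (metis frame_op_inv(3))
  then show ?thesis
    by (simp add: frame_proj_apply cinner_adj cinner_adj_left[symmetric] bounded_analysis)
qed


section \<open>Intertwining operators and invariance of the range\<close>

text \<open>The range of \<open>P\<close> is invariant under \<open>I \<otimes> T\<close>, in the form \<open>(I \<otimes> T)P = P(I \<otimes> T)P\<close>.\<close>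

definition invariant :: "('k \<Rightarrow> 'k) \<Rightarrow> bool"
  where "invariant T \<longleftrightarrow> (\<forall>f. tensor_op id T (P f) = P (tensor_op id T (P f)))"

lemma invariant_iff_comp:
  "tensor_op id T \<circ> P = P \<circ> tensor_op id T \<circ> P \<longleftrightarrow> invariant T"
  by (simp add: invariant_def fun_eq_iff)

lemma invariant_iff_compl:
  "frame_proj_compl A \<circ> tensor_op id T \<circ> P = (\<lambda>_. 0) \<longleftrightarrow> invariant T"
  by (simp add: invariant_def fun_eq_iff frame_proj_compl_def)

lemma intertwines_iff:
  assumes T: "bounded_clinear T"
  shows "(\<forall>i. T \<circ> A i = A i \<circ> U) \<longleftrightarrow> (\<forall>x. tensor_op id T (\<theta> x) = \<theta> (U x))"
  by (auto simp: coord_inject[symmetric] fun_eq_iff tensor_op_id(3)[OF T] coord_analysis)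

lemma intertwiner_eq:
  assumes T: "bounded_clinear T" and U: "\<And>x. tensor_op id T (\<theta> x) = \<theta> (U x)"
  shows "compression T x = S (U x)"
  by (simp add: compression_eq[OF T] U frame_op_eq)

lemma intertwines_iff_invariant:
  assumes T: "bounded_clinear T"
  shows "(\<forall>i. T \<circ> A i = A i \<circ> inv S \<circ> compression T) \<longleftrightarrow> invariant T"
proof -
  have "(\<forall>i. T \<circ> A i = A i \<circ> inv S \<circ> compression T) \<longleftrightarrow>
      (\<forall>x. tensor_op id T (\<theta> x) = P (tensor_op id T (\<theta> x)))"
    using intertwines_iff[OF T, of "inv S \<circ> compression T"]
    by (simp add: o_assoc compression_eq[OF T] frame_proj_apply)
  also have "\<dots> \<longleftrightarrow> invariant T"
    unfolding invariant_def by (metis frame_proj_analysis frame_proj_apply)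
  finally show ?thesis .
qed

lemma invariantI:
  assumes "bounded_clinear T" "\<And>i. T \<circ> A i = A i \<circ> U"
  shows "invariant T"
proof -
  have "tensor_op id T (\<theta> x) = \<theta> (U x)" for x using intertwines_iff assms by blast
  then have "tensor_op id T (P f) = P (tensor_op id T (P f))" for f
    unfolding frame_proj_apply[of f] by (simp add: frame_proj_analysis)
  then show ?thesis by (simp add: invariant_def)
qed

text \<open>The frame operator of \<open>A\<^sub>jU\<close> is \<open>U\<^sup>*SU\<close>.\<close>

lemma op_valued_frame_comp:
  assumes U: "invertible_op U"
  shows "op_valued_frame (\<lambda>j. A j \<circ> U)"
proof -
  note bU = invertible_opD[OF U]
  have "sot_has_sum (\<lambda>j. adj (A j \<circ> U) \<circ> (A j \<circ> U)) (adj U \<circ> S \<circ> U)"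
    unfolding sot_has_sum_def
  proof (intro conjI allI)
    show "bounded_clinear (adj U \<circ> S \<circ> U)"
      by (intro bounded_clinear_comp bounded_clinear_adj bU frame_op_inv)
    fix x
    have "((\<lambda>j. adj U (adj (A j) (A j (U x)))) has_sum adj U (S (U x))) UNIV"
      using frame_op_has_sum[OF frame]
      by (intro bounded_clinear_has_sum[OF bounded_clinear_adj[OF bU(1)]])
        (simp add: sot_has_sum_def)
    then show "((\<lambda>j. (adj (A j \<circ> U) \<circ> (A j \<circ> U)) x) has_sum (adj U \<circ> S \<circ> U) x) UNIV"
      by (simp add: adj_comp bounded_frame bU)
  qed
  moreover have "positive_op (adj U \<circ> S \<circ> U)"
    using frame_op_positive by (simp add: positive_op_def cinner_adj_left bU)
  moreover have "invertible_op (adj U \<circ> S \<circ> U)"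
    by (intro invertible_op_comp invertible_op_adj U frame_op_invertible)
  ultimately show ?thesis
    using bounded_clinear_comp[OF bounded_frame bU(1)] by (auto simp: op_valued_frame_def)
qed

end


section \<open>Multiplying a frame on the left by an invertible operator\<close>

locale op_frame_left_mult = op_frame A
  for A :: "'j \<Rightarrow> 'h::chilbert_space \<Rightarrow> 'k::chilbert_space" +
  fixes R :: "'k \<Rightarrow> 'k"
  assumes R: "invertible_op R"
begin

abbreviation amplification ("V") where "V \<equiv> tensor_op id R :: ('j, 'k) ell2 \<Rightarrow> ('j, 'k) ell2"
abbreviation amplification_inv ("W")
  where "W \<equiv> tensor_op id (inv R) :: ('j, 'k) ell2 \<Rightarrow> ('j, 'k) ell2"

lemmas R_inv = invertible_opD[OF R]

lemma V_W: "V (W f) = f" and W_V: "W (V f) = f"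
  by (simp_all add: tensor_op_id_comp R_inv)

lemma right_similar_iff:
  "right_similar (\<lambda>j. R \<circ> A j) A \<longleftrightarrow> (\<exists>U. invertible_op U \<and> (\<forall>i. R \<circ> A i = A i \<circ> U))"
proof
  assume "right_similar (\<lambda>j. R \<circ> A j) A"
  then obtain T where T: "invertible_op T" "\<And>j. A j = R \<circ> A j \<circ> T"
    unfolding right_similar_def by blast
  have "R \<circ> A i = A i \<circ> inv T" for i
    using T(2)[of i] invertible_opD(3)[OF T(1)] by (metis comp_apply ext)
  with T(1) show "\<exists>U. invertible_op U \<and> (\<forall>i. R \<circ> A i = A i \<circ> U)"
    using invertible_op_inv by blast
next
  assume "\<exists>U. invertible_op U \<and> (\<forall>i. R \<circ> A i = A i \<circ> U)"
  then obtain U where U: "invertible_op U" "\<And>i. R \<circ> A i = A i \<circ> U" by blast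
  have "A j = R \<circ> A j \<circ> inv U" for j
    unfolding U(2) by (simp add: fun_eq_iff invertible_opD[OF U(1)])
  then show "right_similar (\<lambda>j. R \<circ> A j) A"
    unfolding right_similar_def
    using frame op_valued_frame_comp[OF U(1)] invertible_op_inv[OF U(1)]
    by (auto simp: U(2))
qed

lemma inverse_intertwines:
  assumes U: "invertible_op U" and RA: "\<And>i. R \<circ> A i = A i \<circ> U"
  shows "inv R \<circ> A i = A i \<circ> inv U"
proof
  fix x
  have "R (A i (inv U x)) = A i x"
    using fun_cong[OF RA[of i], of "inv U x"] invertible_opD(3)[OF U] by simp
  then show "(inv R \<circ> A i) x = (A i \<circ> inv U) x" using R_inv(4) by (metis comp_apply)
qed

text \<open>
  Invariance under \<open>V\<close> alone gives only a bounded \<open>U\<close> with \<open>RA\<^sub>i = A\<^sub>iU\<close>; invariance under \<open>W\<close>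
  gives its inverse.
\<close>

lemma ex_intertwiner_iff:
  "(\<exists>U. invertible_op U \<and> (\<forall>i. R \<circ> A i = A i \<circ> U)) \<longleftrightarrow> invariant R \<and> invariant (inv R)"
proof
  assume "\<exists>U. invertible_op U \<and> (\<forall>i. R \<circ> A i = A i \<circ> U)"
  then obtain U where U: "invertible_op U" "\<And>i. R \<circ> A i = A i \<circ> U" by blast
  show "invariant R \<and> invariant (inv R)"
    using invariantI[OF R_inv(1) U(2)] invariantI[OF R_inv(2) inverse_intertwines[OF U]] by blast
next
  assume inv: "invariant R \<and> invariant (inv R)"
  define U where "U = inv S \<circ> compression R"
  define U' where "U' = inv S \<circ> compression (inv R)"
  have RA: "\<forall>i. R \<circ> A i = A i \<circ> U" and R'A: "\<forall>i. inv R \<circ> A i = A i \<circ> U'"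
    using inv by (simp_all add: U_def U'_def o_assoc
        intertwines_iff_invariant[OF R_inv(1)] intertwines_iff_invariant[OF R_inv(2)])
  have V: "V (\<theta> x) = \<theta> (U x)" and W: "W (\<theta> x) = \<theta> (U' x)" for x
    using RA R'A intertwines_iff R_inv by blast+
  have "invertible_op U"
  proof (rule invertible_opI)
    show "bounded_clinear U" "bounded_clinear U'"
      unfolding U_def U'_def compression_eq[OF R_inv(1)] compression_eq[OF R_inv(2)]
      by (intro bounded_clinear_comp bounded_clinear_adj bounded_analysis frame_op_inv
          tensor_op_id(1) R_inv)+
    show "U' (U x) = x" "U (U' x) = x" for x
      by (rule analysis_inj, simp add: V[symmetric] W[symmetric] V_W W_V)+
  qed
  with RA show "\<exists>U. invertible_op U \<and> (\<forall>i. R \<circ> A i = A i \<circ> U)" by blast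
qed

lemma invertible_on_range_iff:
  assumes inv: "invariant R"
  shows "invertible_op_on (range P) (V \<circ> P) \<longleftrightarrow> invariant (inv R)"
proof
  assume "invertible_op_on (range P) (V \<circ> P)"
  then obtain Z where "bounded_clinear_on (range P) Z"
    and "\<forall>y\<in>range P. Z ((V \<circ> P) y) = y \<and> (V \<circ> P) (Z y) = y"
    unfolding invertible_op_on_def by blast
  then have Z: "Z ` range P \<subseteq> range P" "\<And>y. y \<in> range P \<Longrightarrow> V (P (Z y)) = y"
    by (auto simp only: bounded_clinear_on_def o_apply)
  \<comment> \<open>On the range of \<open>P\<close> the operators \<open>Z\<close> and \<open>W\<close> agree, so \<open>W\<close> maps this range into itself.\<close>
  have "W (P f) = P (W (P f))" for f
  proof -
    have "Z (P f) \<in> range P" using Z(1) by blast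
    then have "P (Z (P f)) = Z (P f)" using frame_proj_idem by auto
    moreover have "V (P (Z (P f))) = P f" by (rule Z(2)) simp
    ultimately have "W (P f) = Z (P f)" by (metis W_V)
    with \<open>P (Z (P f)) = Z (P f)\<close> show ?thesis by simp
  qed
  then show "invariant (inv R)" by (simp add: invariant_def)
next
  assume inv': "invariant (inv R)"
  have bdd: "bounded_clinear_on (range P) (tensor_op id T \<circ> P)"
    if T: "bounded_clinear T" and "invariant T" for T
  proof -
    have b: "bounded_clinear (tensor_op id T \<circ> P)"
      by (intro bounded_clinear_comp tensor_op_id(1) T bounded_frame_proj)
    then obtain K where "\<And>f. norm ((tensor_op id T \<circ> P) f) \<le> norm f * K"
      by (rule bounded_clinear_bound) blast
    then have "\<exists>K. \<forall>f\<in>range P. norm ((tensor_op id T \<circ> P) f) \<le> K * norm f"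
      by (auto simp: mult.commute)
    moreover have "(tensor_op id T \<circ> P) ` range P \<subseteq> range P"
      using \<open>invariant T\<close> unfolding invariant_def by (metis comp_apply image_subsetI rangeI)
    moreover have "(tensor_op id T \<circ> P) (f + g) = (tensor_op id T \<circ> P) f + (tensor_op id T \<circ> P) g"
      for f g
      using b by (simp only: bounded_clinear_def bounded_linear.linear linear_add)
    ultimately show ?thesis
      using b unfolding bounded_clinear_on_def bounded_clinear_def by blast
  qed
  have "(W \<circ> P) ((V \<circ> P) f) = f \<and> (V \<circ> P) ((W \<circ> P) f) = f" if "f \<in> range P" for f
  proof -
    have "P f = f" using that frame_proj_idem by auto
    with inv inv' have "P (V f) = V f" "P (W f) = W f" by (metis invariant_def)+
    with \<open>P f = f\<close> show ?thesis by (simp add: V_W W_V)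
  qed
  then show "invertible_op_on (range P) (V \<circ> P)"
    using bdd[OF R_inv(1) inv] bdd[OF R_inv(2) inv'] unfolding invertible_op_on_def by blast
qed

text \<open>
  The invertibility of \<open>C = \<Sum>\<^sub>j A\<^sub>j\<^sup>*RA\<^sub>j\<close> alone makes \<open>U = S\<^sup>-\<^sup>1C\<close> invertible; the formula for \<open>C\<^sup>-\<^sup>1\<close> is
  a consequence.
\<close>

lemma compression_inverse_iff:
  "(\<forall>i. R \<circ> A i = A i \<circ> inv S \<circ> compression R) \<and> invertible_op (compression R) \<and>
      inv (compression R) = inv S \<circ> compression (inv R) \<circ> inv S \<longleftrightarrow>
    (\<exists>U. invertible_op U \<and> (\<forall>i. R \<circ> A i = A i \<circ> U))"
proof (intro iffI)
  assume "(\<forall>i. R \<circ> A i = A i \<circ> inv S \<circ> compression R) \<and> invertible_op (compression R) \<and>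
    inv (compression R) = inv S \<circ> compression (inv R) \<circ> inv S"
  then show "\<exists>U. invertible_op U \<and> (\<forall>i. R \<circ> A i = A i \<circ> U)"
    by (intro exI[of _ "inv S \<circ> compression R"])
      (simp add: o_assoc invertible_op_comp invertible_op_inv frame_op_invertible)
next
  assume ex: "\<exists>U. invertible_op U \<and> (\<forall>i. R \<circ> A i = A i \<circ> U)"
  then obtain U where U: "invertible_op U" "\<And>i. R \<circ> A i = A i \<circ> U" by blast
  have V: "V (\<theta> x) = \<theta> (U x)" and W: "W (\<theta> x) = \<theta> (inv U x)" for x
    using U(2) inverse_intertwines[OF U] intertwines_iff R_inv by blast+
  have C: "compression R = S \<circ> U" "compression (inv R) = S \<circ> inv U"
    using intertwiner_eq[OF R_inv(1) V] intertwiner_eq[OF R_inv(2) W] by (auto simp: fun_eq_iff)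
  have "inv (S \<circ> U) = inv S \<circ> (S \<circ> inv U) \<circ> inv S"
    by (rule inv_unique_comp) (simp_all add: fun_eq_iff frame_op_inv invertible_opD[OF U(1)])
  moreover have "invariant R" using ex ex_intertwiner_iff by blast
  ultimately show "(\<forall>i. R \<circ> A i = A i \<circ> inv S \<circ> compression R) \<and> invertible_op (compression R) \<and>
      inv (compression R) = inv S \<circ> compression (inv R) \<circ> inv S"
    using intertwines_iff_invariant[OF R_inv(1)] invertible_op_comp[OF frame_op_invertible U(1)]
    by (simp add: C)
qed

lemma commutes_iff_invariant:
  assumes "unitary_op R"
  shows "V \<circ> P = P \<circ> V \<longleftrightarrow> invariant R \<and> invariant (inv R)"
proof
  assume "V \<circ> P = P \<circ> V"
  then have VP: "V (P f) = P (V f)" for f by (metis comp_apply)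
  then have "W (P f) = P (W f)" for f by (metis V_W W_V)
  with VP show "invariant R \<and> invariant (inv R)" by (simp add: invariant_def frame_proj_idem)
next
  assume inv: "invariant R \<and> invariant (inv R)"
  \<comment> \<open>\<open>V\<close> is unitary, with adjoint \<open>W\<close>.\<close>
  have VW: "cinner (W f) g = cinner f (V g)" for f g
    using adj_tensor_op_id[OF R_inv(1), of g f] inv_unitary_op[OF assms] by (metis cinner_commute)
  show "V \<circ> P = P \<circ> V"
  proof
    fix f
    have "P (V f) = P (V (P f))"
    proof (rule cinner_eqI)
      fix g
      have "cinner g (P (V f)) = cinner (W (P g)) f" by (simp add: VW cinner_frame_proj)
      also have "\<dots> = cinner (P (W (P g))) f" using inv by (metis invariant_def)
      also have "\<dots> = cinner g (P (V (P f)))" by (simp add: VW cinner_frame_proj)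
      finally show "cinner g (P (V f)) = cinner g (P (V (P f)))" .
    qed
    with inv show "(V \<circ> P) f = (P \<circ> V) f" by (metis comp_apply invariant_def)
  qed
qed

lemma commutes_iff_entries:
  "V \<circ> P = P \<circ> V \<longleftrightarrow>
    (\<forall>i j. R \<circ> (A j \<circ> inv S \<circ> adj (A i)) = (A j \<circ> inv S \<circ> adj (A i)) \<circ> R)"
proof -
  have V_basis: "V (tensor_basis i h) = tensor_basis i (R h)" for i h
    by (simp add: tensor_basis_def tensor_op_id(2)[OF R_inv(1)])
  have "V \<circ> P = P \<circ> V \<longleftrightarrow>
      (\<forall>i h. (V \<circ> P) (tensor_basis i h) = (P \<circ> V) (tensor_basis i h))"
    using bounded_clinear_eq_on_basis[of "V \<circ> P" "P \<circ> V"]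
      bounded_clinear_comp tensor_op_id(1)[OF R_inv(1)] bounded_frame_proj by metis
  also have "\<dots> \<longleftrightarrow> (\<forall>i h j. R (A j (inv S (adj (A i) h))) = A j (inv S (adj (A i) (R h))))"
    by (simp add: coord_inject[symmetric] fun_eq_iff tensor_op_id(3)[OF R_inv(1)] V_basis
        coord_frame_proj_basis)
  finally show ?thesis by (auto simp: fun_eq_iff)
qed

end


section \<open>Right similarity of a frame and its left multiple\<close>

theorem proposition4p8:
  fixes A B :: "'j \<Rightarrow> 'h::chilbert_space \<Rightarrow> 'k::chilbert_space"
    and R :: "'k \<Rightarrow> 'k"
  assumes "op_valued_frame A"
    and "invertible_op R"
    and "\<And>j. B j = R \<circ> A j"
  shows "(right_similar B A \<longleftrightarrow>
        tensor_op id R \<circ> frame_proj A = frame_proj A \<circ> tensor_op id R \<circ> frame_proj A \<and>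
        invertible_op_on (range (frame_proj A)) (tensor_op id R \<circ> frame_proj A)) \<and>
    (right_similar B A \<longleftrightarrow>
        frame_proj_compl A \<circ> tensor_op id R \<circ> frame_proj A = (\<lambda>_. 0) \<and>
        frame_proj_compl A \<circ> tensor_op id (inv R) \<circ> frame_proj A = (\<lambda>_. 0)) \<and>
    (right_similar B A \<longleftrightarrow>
        (\<forall>i.
          R \<circ> A i = A i \<circ> inv (frame_op A) \<circ> sot_sum (\<lambda>j. adj (A j) \<circ> R \<circ> A j) \<and>
          inv R \<circ> A i = A i \<circ> inv (frame_op A) \<circ> sot_sum (\<lambda>j. adj (A j) \<circ> inv R \<circ> A j))) \<and>
    (right_similar B A \<longleftrightarrow>
        (\<forall>i. R \<circ> A i = A i \<circ> inv (frame_op A) \<circ> sot_sum (\<lambda>j. adj (A j) \<circ> R \<circ> A j)) \<and>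
        invertible_op (sot_sum (\<lambda>j. adj (A j) \<circ> R \<circ> A j)) \<and>
        inv (sot_sum (\<lambda>j. adj (A j) \<circ> R \<circ> A j)) =
          inv (frame_op A) \<circ> sot_sum (\<lambda>j. adj (A j) \<circ> inv R \<circ> A j) \<circ> inv (frame_op A)) \<and>
    (unitary_op R \<longrightarrow>
      (right_similar B A \<longleftrightarrow>
        tensor_op id R \<circ> frame_proj A = frame_proj A \<circ> tensor_op id R)) \<and>
    (unitary_op R \<longrightarrow>
      (right_similar B A \<longleftrightarrow>
        (\<forall>i j. R \<circ> (A j \<circ> inv (frame_op A) \<circ> adj (A i)) =
          (A j \<circ> inv (frame_op A) \<circ> adj (A i)) \<circ> R)))"
proof -
  interpret op_frame_left_mult A R
    using assms(1,2) by unfold_locales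
  have B: "B = (\<lambda>j. R \<circ> A j)" using assms(3) by blast
  have sim: "right_similar B A \<longleftrightarrow> invariant R \<and> invariant (inv R)"
    unfolding B right_similar_iff ex_intertwiner_iff ..
  note inv_iff = intertwines_iff_invariant[OF R_inv(1)] intertwines_iff_invariant[OF R_inv(2)]
  show ?thesis
    unfolding sim invariant_iff_comp invariant_iff_compl all_conj_distrib inv_iff
    using invertible_on_range_iff commutes_iff_invariant commutes_iff_entries
      compression_inverse_iff[unfolded ex_intertwiner_iff inv_iff]
    by blast
qed

end
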